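(* For any typing context $\Gamma$ (in which a variable may occur with several types), any $\lambda$-term $M$ and any type $A$, the following are equivalent: (1) $\Gamma_\cap\vdash_\omega M:A$ in $\Lambda_{\cap\omega}$; (2) $\Gamma\vdash_{s\omega} M:A$ in $\Lambda_{\cap\omega}^s$; (3) $\Gamma\vdash_{\ell\omega} M:A$ in $\Lambda_{\cap\omega}^\ell$.
   Context: $\lambda$-terms: $M::=x\mid MM\mid\lambda x.M$ modulo $\alpha$-conversion; $M[x:=N]$ capture-avoiding substitution. Types: $A::=\varphi\mid\omega\mid A\to A\mid A\cap A$. A typing context is a finite set of pairs $x:A$ ($\Gamma,x:A$ denotes $\Gamma\cup\{x:A\}$; $x\notin\Gamma$ means no $x:B$ lies in $\Gamma$); in $\Lambda_{\cap\omega}$ variables are pairwise distinct, in the other two systems a variable may occur with several types. $\Gamma_\cap$ assigns to each variable of $\Gamma$ the intersection of all types it has in $\Gamma$. $\Lambda_{\cap\omega}$: (Ax) $\Gamma,x:A\vdash x:A$; ($\to$I) from $\Gamma,x:A\vdash M:B$, $x\notin\Gamma$, infer $\Gamma\vdash\lambda x.M:A\to B$; ($\to$E) from $\Gamma\vdash M:A\to B$ and $\Gamma\vdash N:A$ infer $\Gamma\vdash MN:B$; ($\cap$I) from $\Gamma\vdash M:A$, $\Gamma\vdash M:B$ infer $\Gamma\vdash M:A\cap B$; ($\cap$E) from $\Gamma\vdash M:A\cap B$ infer $\Gamma\vdash M:A$ and $\Gamma\vdash M:B$; $(\omega)$ $\Gamma\vdash M:\omega$. $\Lambda_{\cap\omega}^s$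 ($n\ge0$): (Ax) $\Gamma,x:A\vdash x:A$; $(\mathsf{Beta})^s$ from $\Gamma\vdash M[x:=N]N_1\dots N_n:A$ and $\Gamma\vdash N:B$ infer $\Gamma\vdash(\lambda x.M)NN_1\dots N_n:A$; $(\mathsf{L}\to)$ from $\Gamma\vdash N:A_1$ and $\Gamma,y:A_2\vdash yN_1\dots N_n:B$, with $y\notin FV(N_1)\cup\dots\cup FV(N_n)$, $y\notin\Gamma$, infer $\Gamma,x:A_1\to A_2\vdash xNN_1\dots N_n:B$; $(\mathsf{R}\to)$ from $\Gamma,x:A\vdash M:B$, $x\notin\Gamma$, infer $\Gamma\vdash\lambda x.M:A\to B$; $(\mathsf{L}\cap)$ from $\Gamma,x:A_1,x:A_2\vdash xN_1\dots N_n:B$ infer $\Gamma,x:A_1\cap A_2\vdash xN_1\dots N_n:B$; $(\mathsf{R}\cap)$ from $\Gamma\vdash M:A$ and $\Gamma\vdash M:B$ infer $\Gamma\vdash M:A\cap B$; $(\omega)$ $\Gamma\vdash M:\omega$. $\Lambda_{\cap\omega}^\ell$: same as $\Lambda_{\cap\omega}^s$ but with $(\mathsf{Beta})^s$ replaced by $(\mathsf{Beta})^\ell$: from $\Gamma\vdash M[x:=N]N_1\dots N_n:A$ infer $\Gamma\vdash(\lambda x.M)NN_1\dots N_n:A$. *)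

theory Defs
  imports Main
begin

text \<open>
  Terms modulo \<open>\<alpha>\<close>-conversion are represented by de Bruijn indices; the indices that are not
  bound by any enclosing abstraction are the names of the free variables.
\<close>

datatype tm = Var nat | App tm tm (infixl \<open>\<degree>\<close> 200) | Lam tm

primrec lift :: "tm \<Rightarrow> nat \<Rightarrow> tm" where
  "lift (Var i) k = (if i < k then Var i else Var (Suc i))"
| "lift (M \<degree> N) k = lift M k \<degree> lift N k"
| "lift (Lam M) k = Lam (lift M (Suc k))"

text \<open>
  In \<open>M[k \<^bold>:= N]\<close> the binder of \<open>k\<close> disappears, so the indices above \<open>k\<close> are decremented: the
  \<open>\<beta>\<close>-contractum of \<open>Lam M \<degree> N\<close> is \<open>M[0 \<^bold>:= N]\<close>.
\<close>

primrec subst :: "tm \<Rightarrow> nat \<Rightarrow> tm \<Rightarrow> tm" (\<open>_[_ \<^bold>:= _]\<close> [300, 0, 0] 300) where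
  "(Var i)[k \<^bold>:= N] = (if k < i then Var (i - 1) else if i = k then N else Var i)"
| "(M \<degree> M')[k \<^bold>:= N] = M[k \<^bold>:= N] \<degree> M'[k \<^bold>:= N]"
| "(Lam M)[k \<^bold>:= N] = Lam (M[Suc k \<^bold>:= lift N 0])"

primrec FV :: "tm \<Rightarrow> nat set" where
  "FV (Var i) = {i}"
| "FV (M \<degree> N) = FV M \<union> FV N"
| "FV (Lam M) = {i. Suc i \<in> FV M}"

abbreviation apps :: "tm \<Rightarrow> tm list \<Rightarrow> tm" (infixl \<open>\<degree>\<degree>\<close> 150) where
  "M \<degree>\<degree> Ns \<equiv> foldl (\<degree>) M Ns"

text \<open>The type parameter is the set of type atoms.\<close>

datatype 'a ty =
    Atom 'a
  | Omega
  | Arrow "'a ty" "'a ty" (infixr \<open>\<^bold>\<rightarrow>\<close> 120)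
  | Inter "'a ty" "'a ty" (infixr \<open>\<^bold>\<inter>\<close> 130)

type_synonym 'a ctx = "(nat \<times> 'a ty) set"

abbreviation vars :: "'a ctx \<Rightarrow> nat set" where
  "vars \<Gamma> \<equiv> fst ` \<Gamma>"

text \<open>
  Below an abstraction the outer variables are renumbered by \<open>Suc\<close> and the bound one is \<open>0\<close>.
  Thus \<open>bind A \<Gamma>\<close> is the context \<open>\<Gamma>, x : A\<close> for the body of an abstraction; the condition
  \<open>x \<notin> \<Gamma>\<close> holds by construction.
\<close>

definition bind :: "'a ty \<Rightarrow> 'a ctx \<Rightarrow> 'a ctx" where
  "bind A \<Gamma> = insert (0, A) ((\<lambda>(i, B). (Suc i, B)) ` \<Gamma>)"

text \<open>
  The leaf rules of the three systems require the context to be finite (and, in the first system,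
  its variables to be pairwise distinct); all other rules propagate these conditions from
  the premises to the conclusion.
\<close>

inductive typ_omega :: "'a ctx \<Rightarrow> tm \<Rightarrow> 'a ty \<Rightarrow> bool"
  (\<open>_ \<turnstile>\<^sub>\<omega> _ : _\<close> [50, 50, 50] 50) where
  Ax: "\<lbrakk>finite \<Gamma>; single_valued (insert (x, A) \<Gamma>)\<rbrakk> \<Longrightarrow> insert (x, A) \<Gamma> \<turnstile>\<^sub>\<omega> Var x : A"
| ArrI: "bind A \<Gamma> \<turnstile>\<^sub>\<omega> M : B \<Longrightarrow> \<Gamma> \<turnstile>\<^sub>\<omega> Lam M : A \<^bold>\<rightarrow> B"
| ArrE: "\<lbrakk>\<Gamma> \<turnstile>\<^sub>\<omega> M : A \<^bold>\<rightarrow> B; \<Gamma> \<turnstile>\<^sub>\<omega> N : A\<rbrakk> \<Longrightarrow> \<Gamma> \<turnstile>\<^sub>\<omega> M \<degree> N : B"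
| IntI: "\<lbrakk>\<Gamma> \<turnstile>\<^sub>\<omega> M : A; \<Gamma> \<turnstile>\<^sub>\<omega> M : B\<rbrakk> \<Longrightarrow> \<Gamma> \<turnstile>\<^sub>\<omega> M : A \<^bold>\<inter> B"
| IntE1: "\<Gamma> \<turnstile>\<^sub>\<omega> M : A \<^bold>\<inter> B \<Longrightarrow> \<Gamma> \<turnstile>\<^sub>\<omega> M : A"
| IntE2: "\<Gamma> \<turnstile>\<^sub>\<omega> M : A \<^bold>\<inter> B \<Longrightarrow> \<Gamma> \<turnstile>\<^sub>\<omega> M : B"
| Om: "\<lbrakk>finite \<Gamma>; single_valued \<Gamma>\<rbrakk> \<Longrightarrow> \<Gamma> \<turnstile>\<^sub>\<omega> M : Omega"

inductive typ_s :: "'a ctx \<Rightarrow> tm \<Rightarrow> 'a ty \<Rightarrow> bool"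
  (\<open>_ \<turnstile>\<^sub>s _ : _\<close> [50, 50, 50] 50) where
  Ax: "finite \<Gamma> \<Longrightarrow> insert (x, A) \<Gamma> \<turnstile>\<^sub>s Var x : A"
| Beta: "\<lbrakk>\<Gamma> \<turnstile>\<^sub>s M[0 \<^bold>:= N] \<degree>\<degree> Ns : A; \<Gamma> \<turnstile>\<^sub>s N : B\<rbrakk> \<Longrightarrow> \<Gamma> \<turnstile>\<^sub>s Lam M \<degree> N \<degree>\<degree> Ns : A"
| LArr: "\<lbrakk>\<Gamma> \<turnstile>\<^sub>s N : A1; insert (y, A2) \<Gamma> \<turnstile>\<^sub>s Var y \<degree>\<degree> Ns : B;
    \<forall>P \<in> set Ns. y \<notin> FV P; y \<notin> vars \<Gamma>\<rbrakk>
    \<Longrightarrow> insert (x, A1 \<^bold>\<rightarrow> A2) \<Gamma> \<turnstile>\<^sub>s Var x \<degree> N \<degree>\<degree> Ns : B"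
| RArr: "bind A \<Gamma> \<turnstile>\<^sub>s M : B \<Longrightarrow> \<Gamma> \<turnstile>\<^sub>s Lam M : A \<^bold>\<rightarrow> B"
| LInt: "insert (x, A1) (insert (x, A2) \<Gamma>) \<turnstile>\<^sub>s Var x \<degree>\<degree> Ns : B
    \<Longrightarrow> insert (x, A1 \<^bold>\<inter> A2) \<Gamma> \<turnstile>\<^sub>s Var x \<degree>\<degree> Ns : B"
| RInt: "\<lbrakk>\<Gamma> \<turnstile>\<^sub>s M : A; \<Gamma> \<turnstile>\<^sub>s M : B\<rbrakk> \<Longrightarrow> \<Gamma> \<turnstile>\<^sub>s M : A \<^bold>\<inter> B"
| Om: "finite \<Gamma> \<Longrightarrow> \<Gamma> \<turnstile>\<^sub>s M : Omega"

inductive typ_l :: "'a ctx \<Rightarrow> tm \<Rightarrow> 'a ty \<Rightarrow> bool"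
  (\<open>_ \<turnstile>\<^sub>l _ : _\<close> [50, 50, 50] 50) where
  Ax: "finite \<Gamma> \<Longrightarrow> insert (x, A) \<Gamma> \<turnstile>\<^sub>l Var x : A"
| Beta: "\<Gamma> \<turnstile>\<^sub>l M[0 \<^bold>:= N] \<degree>\<degree> Ns : A \<Longrightarrow> \<Gamma> \<turnstile>\<^sub>l Lam M \<degree> N \<degree>\<degree> Ns : A"
| LArr: "\<lbrakk>\<Gamma> \<turnstile>\<^sub>l N : A1; insert (y, A2) \<Gamma> \<turnstile>\<^sub>l Var y \<degree>\<degree> Ns : B;
    \<forall>P \<in> set Ns. y \<notin> FV P; y \<notin> vars \<Gamma>\<rbrakk>
    \<Longrightarrow> insert (x, A1 \<^bold>\<rightarrow> A2) \<Gamma> \<turnstile>\<^sub>l Var x \<degree> N \<degree>\<degree> Ns : B"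
| RArr: "bind A \<Gamma> \<turnstile>\<^sub>l M : B \<Longrightarrow> \<Gamma> \<turnstile>\<^sub>l Lam M : A \<^bold>\<rightarrow> B"
| LInt: "insert (x, A1) (insert (x, A2) \<Gamma>) \<turnstile>\<^sub>l Var x \<degree>\<degree> Ns : B
    \<Longrightarrow> insert (x, A1 \<^bold>\<inter> A2) \<Gamma> \<turnstile>\<^sub>l Var x \<degree>\<degree> Ns : B"
| RInt: "\<lbrakk>\<Gamma> \<turnstile>\<^sub>l M : A; \<Gamma> \<turnstile>\<^sub>l M : B\<rbrakk> \<Longrightarrow> \<Gamma> \<turnstile>\<^sub>l M : A \<^bold>\<inter> B"
| Om: "finite \<Gamma> \<Longrightarrow> \<Gamma> \<turnstile>\<^sub>l M : Omega"

text \<open>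
  Types are syntactic, so the intersection of a finite nonempty set of types is determined only up
  to the order and the bracketing of its members. \<open>inter_of S A\<close> says that \<open>A\<close> is one of these
  intersections, each member of \<open>S\<close> being used exactly once; \<open>inter_ctx \<Gamma> \<Delta>\<close> says
  that \<open>\<Delta>\<close> is \<open>\<Gamma>\<^sub>\<inter>\<close> for some such choice at each variable.
\<close>

inductive inter_of :: "'a ty set \<Rightarrow> 'a ty \<Rightarrow> bool" where
  single: "inter_of {A} A"
| union: "\<lbrakk>inter_of S A; inter_of T B; S \<inter> T = {}\<rbrakk> \<Longrightarrow> inter_of (S \<union> T) (A \<^bold>\<inter> B)"

definition inter_ctx :: "'a ctx \<Rightarrow> 'a ctx \<Rightarrow> bool" where
  "inter_ctx \<Gamma> \<Delta> \<longleftrightarrow>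
     single_valued \<Delta> \<and> vars \<Delta> = vars \<Gamma> \<and> (\<forall>(x, A) \<in> \<Delta>. inter_of {B. (x, B) \<in> \<Gamma>} A)"

lemma inter_of_exists:
  assumes "finite S" "S \<noteq> {}"
  shows "\<exists>A. inter_of S A"
  using assms
proof (induction S rule: finite_ne_induct)
  case (singleton A)
  then show ?case using inter_of.single by blast
next
  case (insert B S)
  then obtain A where "inter_of S A" by blast
  then have "inter_of ({B} \<union> S) (B \<^bold>\<inter> A)"
    using insert.hyps by (intro inter_of.union inter_of.single) auto
  then show ?case by auto
qed

lemma inter_ctx_exists:
  assumes "finite \<Gamma>"
  shows "\<exists>\<Delta>. inter_ctx \<Gamma> \<Delta>"
proof -
  have "\<exists>A. inter_of {B. (x, B) \<in> \<Gamma>} A" if "x \<in> vars \<Gamma>" for x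
  proof (rule inter_of_exists)
    have "{B. (x, B) \<in> \<Gamma>} \<subseteq> snd ` \<Gamma>" by force
    then show "finite {B. (x, B) \<in> \<Gamma>}" using assms finite_surj by blast
    show "{B. (x, B) \<in> \<Gamma>} \<noteq> {}" using that by auto
  qed
  then obtain f where f: "inter_of {B. (x, B) \<in> \<Gamma>} (f x)" if "x \<in> vars \<Gamma>" for x
    by metis
  have "inter_ctx \<Gamma> ((\<lambda>x. (x, f x)) ` vars \<Gamma>)"
    using f unfolding inter_ctx_def by (auto simp: single_valued_def image_image)
  then show ?thesis by blast
qed

end

theory Submission
  imports Defs
begin

text \<open>
  Since \<open>\<omega>\<close> types every term, the extra premise of the rule Beta of the system \<open>s\<close> is harmless,
  so \<open>s\<close> and \<open>\<ell>\<close> coincide. For the passage from \<open>\<ell>\<close> to natural deduction, the left rules are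
  simulated by substitution and Beta by subject expansion. The converse is a cut elimination,
  obtained from a Kripke logical relation: a term realizes an arrow type in a context if it has that
  type in the system \<open>\<ell>\<close> and, after any renaming into another context, maps realizers to
  realizers. Derivable terms with a variable at the head are realizers, and the realizers of a type
  are closed under head expansion, so every term typable in natural deduction is a realizer of its
  type and hence derivable in \<open>\<ell>\<close>.
\<close>

section \<open>Renaming and parallel substitution\<close>

definition up_ren :: "(nat \<Rightarrow> nat) \<Rightarrow> nat \<Rightarrow> nat" where
  "up_ren r = case_nat 0 (\<lambda>i. Suc (r i))"

definition up :: "(nat \<Rightarrow> tm) \<Rightarrow> nat \<Rightarrow> tm" where
  "up \<sigma> = case_nat (Var 0) (\<lambda>i. lift (\<sigma> i) 0)"

lemma up_ren_simps [simp]: "up_ren r 0 = 0" "up_ren r (Suc i) = Suc (r i)"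
  by (simp_all add: up_ren_def)

lemma up_simps [simp]: "up \<sigma> 0 = Var 0" "up \<sigma> (Suc i) = lift (\<sigma> i) 0"
  by (simp_all add: up_def)

primrec ren :: "(nat \<Rightarrow> nat) \<Rightarrow> tm \<Rightarrow> tm" where
  "ren r (Var i) = Var (r i)"
| "ren r (M \<degree> N) = ren r M \<degree> ren r N"
| "ren r (Lam M) = Lam (ren (up_ren r) M)"

primrec psub :: "(nat \<Rightarrow> tm) \<Rightarrow> tm \<Rightarrow> tm" where
  "psub \<sigma> (Var i) = \<sigma> i"
| "psub \<sigma> (M \<degree> N) = psub \<sigma> M \<degree> psub \<sigma> N"
| "psub \<sigma> (Lam M) = Lam (psub (up \<sigma>) M)"

text \<open>Reading \<open>lift\<close> as a renaming, and \<open>subst\<close> below as a parallel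
  substitution, turns the commutation laws into composition of index maps.\<close>

lemma lift_eq_ren: "lift M k = ren (\<lambda>i. if i < k then i else Suc i) M"
proof (induction M arbitrary: k)
  case (Lam M)
  have "up_ren (\<lambda>i. if i < k then i else Suc i) = (\<lambda>i. if i < Suc k then i else Suc i)"
    by (rule ext) (simp add: up_ren_def split: nat.split)
  then show ?case by (simp add: Lam)
qed auto

lemma lift_0: "lift M 0 = ren Suc M"
  by (simp add: lift_eq_ren)

lemma subst_eq_psub:
  "M[k \<^bold>:= N] = psub (\<lambda>i. if k < i then Var (i - 1) else if i = k then N else Var i) M"
proof (induction M arbitrary: k N)
  case (Lam M)
  have "up (\<lambda>i. if k < i then Var (i - 1) else if i = k then N else Var i) =
    (\<lambda>i. if Suc k < i then Var (i - 1) else if i = Suc k then lift N 0 else Var i)"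
    by (rule ext) (auto simp: up_def split: nat.split)
  then show ?case by (simp add: Lam)
qed auto

lemma subst_0: "M[0 \<^bold>:= N] = psub (case_nat N Var) M"
proof -
  have "(\<lambda>i. if 0 < i then Var (i - 1) else if i = 0 then N else Var i) = case_nat N Var"
    by (rule ext) (simp split: nat.split)
  then show ?thesis by (simp only: subst_eq_psub)
qed

lemma ren_cong: "(\<And>i. i \<in> FV M \<Longrightarrow> r i = r' i) \<Longrightarrow> ren r M = ren r' M"
proof (induction M arbitrary: r r')
  case (Lam M)
  have "ren (up_ren r) M = ren (up_ren r') M"
    using Lam.prems by (intro Lam.IH) (auto simp: up_ren_def split: nat.split)
  then show ?case by simp
next
  case (App M N)
  have "ren r M = ren r' M" "ren r N = ren r' N"
    by (rule App.IH, simp add: App.prems)+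
  then show ?case by simp
qed simp

lemma psub_cong: "(\<And>i. i \<in> FV M \<Longrightarrow> \<sigma> i = \<tau> i) \<Longrightarrow> psub \<sigma> M = psub \<tau> M"
proof (induction M arbitrary: \<sigma> \<tau>)
  case (Lam M)
  have "psub (up \<sigma>) M = psub (up \<tau>) M"
    using Lam.prems by (intro Lam.IH) (auto simp: up_def split: nat.split)
  then show ?case by simp
next
  case (App M N)
  have "psub \<sigma> M = psub \<tau> M" "psub \<sigma> N = psub \<tau> N"
    by (rule App.IH, simp add: App.prems)+
  then show ?case by simp
qed simp

lemma ren_id [simp]: "ren (\<lambda>i. i) M = M"
proof (induction M)
  case (Lam M)
  have "up_ren (\<lambda>i. i) = (\<lambda>i. i)"
    by (rule ext) (simp add: up_ren_def split: nat.split)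
  with Lam show ?case by simp
qed auto

lemma psub_Var [simp]: "psub Var M = M"
proof (induction M)
  case (Lam M)
  have "up Var = Var"
    by (rule ext) (simp add: up_def split: nat.split)
  with Lam show ?case by simp
qed auto

lemma ren_ren: "ren r (ren r' M) = ren (\<lambda>i. r (r' i)) M"
proof (induction M arbitrary: r r')
  case (Lam M)
  have "(\<lambda>i. up_ren r (up_ren r' i)) = up_ren (\<lambda>i. r (r' i))"
    by (rule ext) (simp add: up_ren_def split: nat.split)
  with Lam show ?case by simp
qed auto

lemma psub_ren: "psub \<sigma> (ren r M) = psub (\<lambda>i. \<sigma> (r i)) M"
proof (induction M arbitrary: r \<sigma>)
  case (Lam M)
  have "(\<lambda>i. up \<sigma> (up_ren r i)) = up (\<lambda>i. \<sigma> (r i))"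
    by (rule ext) (simp add: up_ren_def split: nat.split)
  with Lam show ?case by simp
qed auto

lemma ren_psub: "ren r (psub \<sigma> M) = psub (\<lambda>i. ren r (\<sigma> i)) M"
proof (induction M arbitrary: r \<sigma>)
  case (Lam M)
  have "(\<lambda>i. ren (up_ren r) (up \<sigma> i)) = up (\<lambda>i. ren r (\<sigma> i))"
    by (rule ext) (simp add: up_def lift_0 ren_ren split: nat.split)
  with Lam show ?case by simp
qed auto

text \<open>The entries of \<open>up\<close> are lifted, that is renamed, so the case of an
  abstraction rests on \<open>psub_ren\<close> and \<open>ren_psub\<close>.\<close>

lemma psub_psub: "psub \<sigma> (psub \<tau> M) = psub (\<lambda>i. psub \<sigma> (\<tau> i)) M"
proof (induction M arbitrary: \<sigma> \<tau>)
  case (Lam M)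
  have "(\<lambda>i. psub (up \<sigma>) (up \<tau> i)) = up (\<lambda>i. psub \<sigma> (\<tau> i))"
    by (rule ext) (simp add: up_def lift_0 psub_ren ren_psub split: nat.split)
  with Lam show ?case by simp
qed auto

lemma ren_subst: "ren r (M[0 \<^bold>:= N]) = (ren (up_ren r) M)[0 \<^bold>:= ren r N]"
  unfolding subst_0 ren_psub psub_ren
  by (rule arg_cong[where f = "\<lambda>\<sigma>. psub \<sigma> M"], rule ext) (simp add: up_ren_def split: nat.split)

text \<open>This is how the logical relation meets a redex: when the body was substituted under its
  binder, contraction just extends the substitution by the argument.\<close>

lemma psub_up_subst: "(psub (up \<sigma>) M)[0 \<^bold>:= N] = psub (case_nat N \<sigma>) M"
  unfolding subst_0 psub_psub
  by (rule arg_cong[where f = "\<lambda>\<sigma>. psub \<sigma> M"], rule ext)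
    (simp add: up_def lift_0 psub_ren split: nat.split)

lemma ren_apps [simp]: "ren r (M \<degree>\<degree> Ns) = ren r M \<degree>\<degree> map (ren r) Ns"
  by (induction Ns arbitrary: M) auto

lemma psub_apps [simp]: "psub \<sigma> (M \<degree>\<degree> Ns) = psub \<sigma> M \<degree>\<degree> map (psub \<sigma>) Ns"
  by (induction Ns arbitrary: M) auto

lemma finite_FV [simp]: "finite (FV M)"
proof (induction M)
  case (Lam M)
  have "FV (Lam M) = Suc -` FV M" by auto
  then show ?case using Lam by (simp add: finite_vimageI)
qed auto

lemma FV_ren: "FV (ren r M) = r ` FV M"
proof (induction M arbitrary: r)
  case (Lam M)
  have "i \<in> FV (Lam (ren (up_ren r) M)) \<longleftrightarrow> i \<in> r ` FV (Lam M)" for i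
  proof -
    have "Suc i = up_ren r j \<longleftrightarrow> (\<exists>k. j = Suc k \<and> i = r k)" for j
      by (cases j) auto
    then show ?thesis by (auto simp: Lam image_iff)
  qed
  then show ?case by auto
qed auto

section \<open>Contexts under a binder\<close>

lemma mem_bind [simp]:
  "(0, B) \<in> bind A \<Gamma> \<longleftrightarrow> B = A" "(Suc i, B) \<in> bind A \<Gamma> \<longleftrightarrow> (i, B) \<in> \<Gamma>"
  by (auto simp: bind_def)

lemma finite_bind [simp]: "finite (bind A \<Gamma>) \<longleftrightarrow> finite \<Gamma>"
proof -
  have "inj_on (\<lambda>(i, B). (Suc i, B)) \<Gamma>" by (auto simp: inj_on_def)
  then show ?thesis by (simp add: bind_def finite_image_iff)
qed

lemma single_valued_bind [simp]: "single_valued (bind A \<Gamma>) \<longleftrightarrow> single_valued \<Gamma>"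
proof
  assume *: "single_valued (bind A \<Gamma>)"
  show "single_valued \<Gamma>"
  proof (rule single_valuedI)
    fix i B C
    assume "(i, B) \<in> \<Gamma>" "(i, C) \<in> \<Gamma>"
    then have "(Suc i, B) \<in> bind A \<Gamma>" "(Suc i, C) \<in> bind A \<Gamma>" by simp_all
    with * show "B = C" by (blast dest: single_valuedD)
  qed
next
  assume *: "single_valued \<Gamma>"
  show "single_valued (bind A \<Gamma>)"
  proof (rule single_valuedI)
    fix i B C
    assume "(i, B) \<in> bind A \<Gamma>" "(i, C) \<in> bind A \<Gamma>"
    with * show "B = C" by (cases i) (auto dest: single_valuedD)
  qed
qed

section \<open>Natural deduction\<close>

lemma typ_omega_ctx: "\<Gamma> \<turnstile>\<^sub>\<omega> M : A \<Longrightarrow> finite \<Gamma> \<and> single_valued \<Gamma>"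
  by (induction rule: typ_omega.induct) auto

lemma typ_omega_Var:
  "\<lbrakk>(x, A) \<in> \<Gamma>; finite \<Gamma>; single_valued \<Gamma>\<rbrakk> \<Longrightarrow> \<Gamma> \<turnstile>\<^sub>\<omega> Var x : A"
  using typ_omega.Ax[of \<Gamma> x A] by (simp add: insert_absorb)

text \<open>Only the free variables of \<open>M\<close> have to be mapped, so this covers weakening,
  strengthening and renamings that are not injective.\<close>

lemma typ_omega_ren:
  assumes "\<Gamma> \<turnstile>\<^sub>\<omega> M : A" "finite \<Gamma>'" "single_valued \<Gamma>'"
    and "\<And>x B. \<lbrakk>x \<in> FV M; (x, B) \<in> \<Gamma>\<rbrakk> \<Longrightarrow> (r x, B) \<in> \<Gamma>'"
  shows "\<Gamma>' \<turnstile>\<^sub>\<omega> ren r M : A"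
  using assms
proof (induction arbitrary: \<Gamma>' r rule: typ_omega.induct)
  case (Ax \<Gamma> x A)
  then show ?case by (auto intro: typ_omega_Var)
next
  case (ArrI A \<Gamma> M B)
  have "(up_ren r x, C) \<in> bind A \<Gamma>'" if "x \<in> FV M" "(x, C) \<in> bind A \<Gamma>" for x C
    using that ArrI.prems by (cases x) auto
  then have "bind A \<Gamma>' \<turnstile>\<^sub>\<omega> ren (up_ren r) M : B"
    using ArrI.prems by (intro ArrI.IH) auto
  then show ?case by (simp add: typ_omega.ArrI)
next
  case (ArrE \<Gamma> M A B N)
  then show ?case by (auto intro!: typ_omega.ArrE[where A = A])
next
  case (IntE1 \<Gamma> M A B)
  show ?case by (rule typ_omega.IntE1[OF IntE1.IH[OF IntE1.prems]])
next
  case (IntE2 \<Gamma> M A B)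
  show ?case by (rule typ_omega.IntE2[OF IntE2.IH[OF IntE2.prems]])
qed (auto intro: typ_omega.IntI typ_omega.Om)

lemma typ_omega_lift_iff: "bind A \<Gamma> \<turnstile>\<^sub>\<omega> lift M 0 : B \<longleftrightarrow> \<Gamma> \<turnstile>\<^sub>\<omega> M : B"
proof
  assume *: "bind A \<Gamma> \<turnstile>\<^sub>\<omega> lift M 0 : B"
  \<comment> \<open>The predecessor map undoes the lifting; it may collapse \<open>0\<close> and
    \<open>1\<close> because \<open>0\<close> is not free in a lifted term.\<close>
  have "\<Gamma> \<turnstile>\<^sub>\<omega> ren (\<lambda>i. i - 1) (lift M 0) : B"
    using typ_omega_ctx[OF *] by (intro typ_omega_ren[OF *]) (auto simp: lift_0 FV_ren)
  then show "\<Gamma> \<turnstile>\<^sub>\<omega> M : B" by (simp add: lift_0 ren_ren)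
next
  assume *: "\<Gamma> \<turnstile>\<^sub>\<omega> M : B"
  then show "bind A \<Gamma> \<turnstile>\<^sub>\<omega> lift M 0 : B"
    using typ_omega_ctx[OF *] unfolding lift_0 by (intro typ_omega_ren[OF *]) auto
qed

lemma typ_omega_psub:
  assumes "\<Gamma> \<turnstile>\<^sub>\<omega> M : A" "finite \<Gamma>'" "single_valued \<Gamma>'"
    and "\<And>x B. (x, B) \<in> \<Gamma> \<Longrightarrow> \<Gamma>' \<turnstile>\<^sub>\<omega> \<sigma> x : B"
  shows "\<Gamma>' \<turnstile>\<^sub>\<omega> psub \<sigma> M : A"
  using assms
proof (induction arbitrary: \<Gamma>' \<sigma> rule: typ_omega.induct)
  case (ArrI A \<Gamma> M B)
  have "bind A \<Gamma>' \<turnstile>\<^sub>\<omega> up \<sigma> x : C" if "(x, C) \<in> bind A \<Gamma>" for x C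
    using that ArrI.prems
    by (cases x) (auto simp: typ_omega_lift_iff intro: typ_omega_Var)
  then have "bind A \<Gamma>' \<turnstile>\<^sub>\<omega> psub (up \<sigma>) M : B"
    using ArrI.prems by (intro ArrI.IH) auto
  then show ?case by (simp add: typ_omega.ArrI)
next
  case (ArrE \<Gamma> M A B N)
  then show ?case by (auto intro!: typ_omega.ArrE[where A = A])
next
  case (IntE1 \<Gamma> M A B)
  show ?case by (rule typ_omega.IntE1[OF IntE1.IH[OF IntE1.prems]])
next
  case (IntE2 \<Gamma> M A B)
  show ?case by (rule typ_omega.IntE2[OF IntE2.IH[OF IntE2.prems]])
qed (auto intro: typ_omega.IntI typ_omega.Om)

text \<open>The substitution lemma for \<open>Var\<close>: a context may be exchanged for any other
  that derives the same types for its variables.\<close>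

lemma typ_omega_ctx_mono:
  assumes "\<Gamma> \<turnstile>\<^sub>\<omega> M : A" "finite \<Gamma>'" "single_valued \<Gamma>'"
    and "\<And>x B. (x, B) \<in> \<Gamma> \<Longrightarrow> \<Gamma>' \<turnstile>\<^sub>\<omega> Var x : B"
  shows "\<Gamma>' \<turnstile>\<^sub>\<omega> M : A"
  using typ_omega_psub[of \<Gamma> M A \<Gamma>' Var] assms by simp

section \<open>Inversion of substitution and subject expansion\<close>

text \<open>Such contexts are single-valued by construction, and two of them merge by pointwise
  intersection of the types.\<close>

definition graph_on :: "(nat \<Rightarrow> 'a ty) \<Rightarrow> nat set \<Rightarrow> 'a ctx" where
  "graph_on f X = (\<lambda>x. (x, f x)) ` X"

lemma mem_graph_on [simp]: "(x, A) \<in> graph_on f X \<longleftrightarrow> x \<in> X \<and> A = f x"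
  by (auto simp: graph_on_def)

lemma finite_graph_on [simp]: "finite X \<Longrightarrow> finite (graph_on f X)"
  by (simp add: graph_on_def)

lemma single_valued_graph_on [simp]: "single_valued (graph_on f X)"
  by (auto simp: single_valued_def)

text \<open>Intersection elimination at each variable recovers \<open>f\<close>. Both orders occur
  because the two derivations to be merged supply the left and the right components.\<close>

lemma typ_omega_graph_on_inter:
  assumes "graph_on f X \<turnstile>\<^sub>\<omega> M : A" "X \<subseteq> Y" "finite Y"
  shows "graph_on (\<lambda>x. f x \<^bold>\<inter> g x) Y \<turnstile>\<^sub>\<omega> M : A" "graph_on (\<lambda>x. g x \<^bold>\<inter> f x) Y \<turnstile>\<^sub>\<omega> M : A"
proof -
  have "graph_on (\<lambda>x. f x \<^bold>\<inter> g x) Y \<turnstile>\<^sub>\<omega> Var x : f x"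
    and "graph_on (\<lambda>x. g x \<^bold>\<inter> f x) Y \<turnstile>\<^sub>\<omega> Var x : f x" if "x \<in> X" for x
  proof -
    have "graph_on (\<lambda>x. f x \<^bold>\<inter> g x) Y \<turnstile>\<^sub>\<omega> Var x : f x \<^bold>\<inter> g x"
      and "graph_on (\<lambda>x. g x \<^bold>\<inter> f x) Y \<turnstile>\<^sub>\<omega> Var x : g x \<^bold>\<inter> f x"
      using that assms(2,3) by (auto intro!: typ_omega_Var)
    then show "graph_on (\<lambda>x. f x \<^bold>\<inter> g x) Y \<turnstile>\<^sub>\<omega> Var x : f x"
      and "graph_on (\<lambda>x. g x \<^bold>\<inter> f x) Y \<turnstile>\<^sub>\<omega> Var x : f x"
      by (auto dest: typ_omega.IntE1 typ_omega.IntE2)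
  qed
  then show "graph_on (\<lambda>x. f x \<^bold>\<inter> g x) Y \<turnstile>\<^sub>\<omega> M : A"
    and "graph_on (\<lambda>x. g x \<^bold>\<inter> f x) Y \<turnstile>\<^sub>\<omega> M : A"
    using assms(3) by (auto intro: typ_omega_ctx_mono[OF assms(1)])
qed

text \<open>The derivation for \<open>\<sigma> x\<close> may end with any rule, so its whole type
  goes to \<open>x\<close>; every other variable gets \<open>Omega\<close>, which all terms
  have.\<close>

lemma typ_omega_psub_inv_Var:
  assumes "\<Gamma> \<turnstile>\<^sub>\<omega> \<sigma> x : A"
  shows "\<exists>f. (\<forall>x. \<Gamma> \<turnstile>\<^sub>\<omega> \<sigma> x : f x) \<and> graph_on f {x} \<turnstile>\<^sub>\<omega> Var x : A"
  using assms typ_omega_ctx[OF assms]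
  by (intro exI[of _ "(\<lambda>_. Omega)(x := A)"]) (auto intro: typ_omega.Om typ_omega_Var)

text \<open>Each variable receives an intersection of the types that its substituted copies have in
  the derivation, built from \<open>Omega\<close> where there are none. In a rule for abstraction or
  application, \<open>M\<close> either is a variable, and \<open>typ_omega_psub_inv_Var\<close>
  closes the case, or has the matching constructor.\<close>

lemma typ_omega_psub_inv:
  assumes "\<Gamma> \<turnstile>\<^sub>\<omega> psub \<sigma> M : A"
  shows "\<exists>f. (\<forall>x. \<Gamma> \<turnstile>\<^sub>\<omega> \<sigma> x : f x) \<and> graph_on f (FV M) \<turnstile>\<^sub>\<omega> M : A"
  using assms
proof (induction \<Gamma> "psub \<sigma> M" A arbitrary: \<sigma> M rule: typ_omega.induct)
  case (Ax \<Gamma> x A)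
  then obtain z where "M = Var z" by (cases M) auto
  moreover have "insert (x, A) \<Gamma> \<turnstile>\<^sub>\<omega> Var x : A" using Ax(1,2) by (rule typ_omega.Ax)
  ultimately show ?case
    using typ_omega_psub_inv_Var[of _ \<sigma> z] Ax by auto
next
  case (ArrI A \<Gamma> P B)
  show ?case
  proof (cases M)
    case (Var z)
    moreover have "\<Gamma> \<turnstile>\<^sub>\<omega> Lam P : A \<^bold>\<rightarrow> B" using ArrI(1) by (rule typ_omega.ArrI)
    ultimately show ?thesis
      using typ_omega_psub_inv_Var[of _ \<sigma> z] ArrI by auto
  next
    case (App M1 M2)
    then show ?thesis using ArrI by simp
  next
    case (Lam Q)
    then obtain f where f: "\<And>x. bind A \<Gamma> \<turnstile>\<^sub>\<omega> up \<sigma> x : f x" "graph_on f (FV Q) \<turnstile>\<^sub>\<omega> Q : B"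
      using ArrI(2)[of "up \<sigma>" Q] ArrI(3) by auto
    define g where "g x = f (Suc x)" for x
    let ?\<Theta> = "graph_on g (FV M)"
    have g: "\<Gamma> \<turnstile>\<^sub>\<omega> \<sigma> x : g x" for x
      using f(1)[of "Suc x"] by (simp add: g_def typ_omega_lift_iff)
    \<comment> \<open>Since \<open>up \<sigma>\<close> sends \<open>0\<close> to
      \<open>Var 0\<close>, the type \<open>f 0\<close> is derivable from \<open>A\<close>, so
      \<open>A\<close> may replace it in the context of the body.\<close>
    have "bind A ?\<Theta> \<turnstile>\<^sub>\<omega> ren (\<lambda>i. i) (Var 0) : f 0"
      using f(1)[of 0] by (intro typ_omega_ren) auto
    moreover have "bind A ?\<Theta> \<turnstile>\<^sub>\<omega> Var (Suc i) : f (Suc i)" if "Suc i \<in> FV Q" for i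
      using that Lam by (intro typ_omega_Var) (simp_all add: g_def del: FV.simps, simp)
    ultimately have "bind A ?\<Theta> \<turnstile>\<^sub>\<omega> Var x : C" if "(x, C) \<in> graph_on f (FV Q)" for x C
      using that by (cases x) auto
    then have "bind A ?\<Theta> \<turnstile>\<^sub>\<omega> Q : B"
      by (intro typ_omega_ctx_mono[OF f(2)]) auto
    then have "?\<Theta> \<turnstile>\<^sub>\<omega> M : A \<^bold>\<rightarrow> B" using Lam by (simp add: typ_omega.ArrI)
    with g show ?thesis by blast
  qed
next
  case (ArrE \<Gamma> P A B N)
  show ?case
  proof (cases M)
    case (Var z)
    moreover have "\<Gamma> \<turnstile>\<^sub>\<omega> P \<degree> N : B" using ArrE(1,3) by (rule typ_omega.ArrE)
    ultimately show ?thesis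
      using typ_omega_psub_inv_Var[of _ \<sigma> z] ArrE by auto
  next
    case (App M1 M2)
    then obtain f g where f: "\<And>x. \<Gamma> \<turnstile>\<^sub>\<omega> \<sigma> x : f x" "graph_on f (FV M1) \<turnstile>\<^sub>\<omega> M1 : A \<^bold>\<rightarrow> B"
      and g: "\<And>x. \<Gamma> \<turnstile>\<^sub>\<omega> \<sigma> x : g x" "graph_on g (FV M2) \<turnstile>\<^sub>\<omega> M2 : A"
      using ArrE(2)[of \<sigma> M1] ArrE(4)[of \<sigma> M2] ArrE(5) by auto
    \<comment> \<open>The two premises may want different types for the same variable; the pointwise
      intersection serves both.\<close>
    let ?h = "\<lambda>x. f x \<^bold>\<inter> g x"
    have "graph_on ?h (FV M) \<turnstile>\<^sub>\<omega> M1 : A \<^bold>\<rightarrow> B" "graph_on ?h (FV M) \<turnstile>\<^sub>\<omega> M2 : A"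
      using App by (auto intro: typ_omega_graph_on_inter f(2) g(2))
    then have "graph_on ?h (FV M) \<turnstile>\<^sub>\<omega> M : B" unfolding App by (rule typ_omega.ArrE)
    moreover have "\<forall>x. \<Gamma> \<turnstile>\<^sub>\<omega> \<sigma> x : ?h x" using f(1) g(1) by (auto intro: typ_omega.IntI)
    ultimately show ?thesis by (intro exI[of _ ?h]) simp
  next
    case (Lam Q)
    then show ?thesis using ArrE by simp
  qed
next
  case (IntI \<Gamma> A B)
  then obtain f g where f: "\<And>x. \<Gamma> \<turnstile>\<^sub>\<omega> \<sigma> x : f x" "graph_on f (FV M) \<turnstile>\<^sub>\<omega> M : A"
    and g: "\<And>x. \<Gamma> \<turnstile>\<^sub>\<omega> \<sigma> x : g x" "graph_on g (FV M) \<turnstile>\<^sub>\<omega> M : B"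
    by blast
  let ?h = "\<lambda>x. f x \<^bold>\<inter> g x"
  have "graph_on ?h (FV M) \<turnstile>\<^sub>\<omega> M : A" "graph_on ?h (FV M) \<turnstile>\<^sub>\<omega> M : B"
    by (auto intro: typ_omega_graph_on_inter f(2) g(2))
  then have "graph_on ?h (FV M) \<turnstile>\<^sub>\<omega> M : A \<^bold>\<inter> B" by (rule typ_omega.IntI)
  moreover have "\<forall>x. \<Gamma> \<turnstile>\<^sub>\<omega> \<sigma> x : ?h x" using f(1) g(1) by (auto intro: typ_omega.IntI)
  ultimately show ?case by (intro exI[of _ ?h]) simp
next
  case (IntE1 \<Gamma> A B)
  then show ?case by (blast intro: typ_omega.IntE1)
next
  case (IntE2 \<Gamma> A B)
  then show ?case by (blast intro: typ_omega.IntE2)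
next
  case (Om \<Gamma>)
  then show ?case by (intro exI[of _ "\<lambda>_. Omega"]) (auto intro: typ_omega.Om)
qed

text \<open>Inversion for the substitution \<open>case_nat N Var\<close> yields a type
  \<open>f 0\<close> of \<open>N\<close> to serve as argument type, even if the bound variable does
  not occur in \<open>M\<close>.\<close>

lemma typ_omega_beta_expand:
  assumes "\<Gamma> \<turnstile>\<^sub>\<omega> M[0 \<^bold>:= N] : A"
  shows "\<Gamma> \<turnstile>\<^sub>\<omega> Lam M \<degree> N : A"
proof -
  obtain f where f: "\<And>x. \<Gamma> \<turnstile>\<^sub>\<omega> case_nat N Var x : f x" "graph_on f (FV M) \<turnstile>\<^sub>\<omega> M : A"
    using assms typ_omega_psub_inv unfolding subst_0 by blast
  have ctx: "finite \<Gamma>" "single_valued \<Gamma>" using typ_omega_ctx[OF assms] by auto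
  have "bind (f 0) \<Gamma> \<turnstile>\<^sub>\<omega> Var x : f x" for x
  proof (cases x)
    case 0
    then show ?thesis using ctx by (auto intro: typ_omega_Var)
  next
    case (Suc i)
    then show ?thesis
      using f(1)[of x] typ_omega_lift_iff[of "f 0" \<Gamma> "Var i" "f x"] by simp
  qed
  then have "bind (f 0) \<Gamma> \<turnstile>\<^sub>\<omega> M : A"
    using ctx by (intro typ_omega_ctx_mono[OF f(2)]) auto
  then show ?thesis
    using f(1)[of 0] by (auto intro: typ_omega.ArrI typ_omega.ArrE)
qed

text \<open>A derivation for an application may end with intersection rules or \<open>Om\<close>;
  the induction descends to the uses of \<open>ArrE\<close>, where the head can be
  exchanged.\<close>

lemma typ_omega_App_mono:
  assumes "\<Gamma> \<turnstile>\<^sub>\<omega> M \<degree> N : A" "\<And>B. \<Gamma> \<turnstile>\<^sub>\<omega> M : B \<Longrightarrow> \<Gamma> \<turnstile>\<^sub>\<omega> M' : B"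
  shows "\<Gamma> \<turnstile>\<^sub>\<omega> M' \<degree> N : A"
  using assms
proof (induction \<Gamma> "M \<degree> N" A rule: typ_omega.induct)
  case (ArrE \<Gamma> A B)
  from ArrE.prems[OF ArrE.hyps(1)] ArrE.hyps(3) show ?case by (rule typ_omega.ArrE)
next
  case (IntE1 \<Gamma> A B)
  from IntE1.hyps(2)[OF IntE1.prems] show ?case by (rule typ_omega.IntE1)
next
  case (IntE2 \<Gamma> A B)
  from IntE2.hyps(2)[OF IntE2.prems] show ?case by (rule typ_omega.IntE2)
qed (auto intro: typ_omega.IntI typ_omega.Om)

lemma typ_omega_apps_mono:
  assumes "\<Gamma> \<turnstile>\<^sub>\<omega> M \<degree>\<degree> Ns : A" "\<And>B. \<Gamma> \<turnstile>\<^sub>\<omega> M : B \<Longrightarrow> \<Gamma> \<turnstile>\<^sub>\<omega> M' : B"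
  shows "\<Gamma> \<turnstile>\<^sub>\<omega> M' \<degree>\<degree> Ns : A"
  using assms
proof (induction Ns arbitrary: M M')
  case (Cons N Ns)
  have "\<Gamma> \<turnstile>\<^sub>\<omega> M' \<degree> N : B" if "\<Gamma> \<turnstile>\<^sub>\<omega> M \<degree> N : B" for B
    using that Cons.prems(2) by (rule typ_omega_App_mono)
  then show ?case using Cons.IH[of "M \<degree> N" "M' \<degree> N"] Cons.prems(1) by simp
qed simp

section \<open>From the system \<ell> to natural deduction\<close>

text \<open>Comparing contexts only through the types derivable for variables lets a single-valued
  \<open>\<Delta>\<close> stand for a multi-typed \<open>\<Gamma>\<close>, and this relation
  survives the left rules.\<close>

lemma typ_l_imp_typ_omega:
  assumes "\<Gamma> \<turnstile>\<^sub>l M : A" "finite \<Delta>" "single_valued \<Delta>"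
    and "\<And>x B. (x, B) \<in> \<Gamma> \<Longrightarrow> \<Delta> \<turnstile>\<^sub>\<omega> Var x : B"
  shows "\<Delta> \<turnstile>\<^sub>\<omega> M : A"
  using assms
proof (induction arbitrary: \<Delta> rule: typ_l.induct)
  case (Beta \<Gamma> M N Ns A)
  then have "\<Delta> \<turnstile>\<^sub>\<omega> M[0 \<^bold>:= N] \<degree>\<degree> Ns : A" by blast
  then show ?case using typ_omega_beta_expand by (rule typ_omega_apps_mono)
next
  case (LArr \<Gamma> N A1 y A2 Ns B x)
  have xN: "\<Delta> \<turnstile>\<^sub>\<omega> Var x \<degree> N : A2"
    using LArr.prems by (auto intro!: typ_omega.ArrE[where A = A1] LArr.IH(1))
  \<comment> \<open>Though fresh for \<open>\<Gamma>\<close>, \<open>y\<close> may occur in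
    \<open>\<Delta>\<close>; its old entry is removed to keep the context single-valued.\<close>
  let ?\<Delta> = "insert (y, A2) {(z, C) \<in> \<Delta>. z \<noteq> y}"
  have fin: "finite ?\<Delta>"
    using LArr.prems(1) by (auto intro: rev_finite_subset)
  have sv: "single_valued ?\<Delta>"
    using LArr.prems(2) by (auto simp: single_valued_def)
  have "?\<Delta> \<turnstile>\<^sub>\<omega> Var z : C" if zC: "(z, C) \<in> insert (y, A2) \<Gamma>" for z C
  proof (cases "z = y")
    case True
    then have "C = A2" using zC LArr.hyps by force
    then show ?thesis using True fin sv by (auto intro: typ_omega_Var)
  next
    case False
    then have "\<Delta> \<turnstile>\<^sub>\<omega> Var z : C" using zC LArr.prems by auto
    from typ_omega_ren[OF this fin sv, of "\<lambda>i. i"] False show ?thesis by auto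
  qed
  then have "?\<Delta> \<turnstile>\<^sub>\<omega> Var y \<degree>\<degree> Ns : B" using fin sv by (intro LArr.IH(2))
  \<comment> \<open>Putting \<open>Var x \<degree> N\<close> for \<open>y\<close> gives the
    conclusion of the rule, as freshness of \<open>y\<close> leaves \<open>Ns\<close>
    unchanged.\<close>
  then have "\<Delta> \<turnstile>\<^sub>\<omega> psub (Var(y := Var x \<degree> N)) (Var y \<degree>\<degree> Ns) : B"
    using LArr.prems xN by (elim typ_omega_psub) (auto intro: typ_omega_Var)
  moreover have "psub (Var(y := Var x \<degree> N)) P = P" if "P \<in> set Ns" for P
  proof -
    have "psub (Var(y := Var x \<degree> N)) P = psub Var P"
      using that LArr.hyps by (intro psub_cong) auto
    then show ?thesis by simp
  qed
  then have "map (psub (Var(y := Var x \<degree> N))) Ns = Ns" by (simp add: map_idI)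
  ultimately show ?case by simp
next
  case (RArr A \<Gamma> M B)
  have "bind A \<Delta> \<turnstile>\<^sub>\<omega> Var x : C" if "(x, C) \<in> bind A \<Gamma>" for x C
  proof (cases x)
    case 0
    then show ?thesis using that RArr.prems by (auto intro: typ_omega_Var)
  next
    case (Suc i)
    then show ?thesis
      using that RArr.prems typ_omega_lift_iff[of A \<Delta> "Var i" C] by simp
  qed
  then show ?case using RArr.prems by (auto intro!: typ_omega.ArrI RArr.IH)
next
  case (LInt x A1 A2 \<Gamma> Ns B)
  then have "\<Delta> \<turnstile>\<^sub>\<omega> Var x : A1 \<^bold>\<inter> A2" by auto
  then have "\<Delta> \<turnstile>\<^sub>\<omega> Var x : A1" "\<Delta> \<turnstile>\<^sub>\<omega> Var x : A2"
    by (auto dest: typ_omega.IntE1 typ_omega.IntE2)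
  then show ?case using LInt.prems by (auto intro!: LInt.IH)
qed (auto intro: typ_omega.IntI typ_omega.Om)

section \<open>The system \<open>\<ell>\<close>\<close>

lemma typ_l_finite: "\<Gamma> \<turnstile>\<^sub>l M : A \<Longrightarrow> finite \<Gamma>"
  by (induction rule: typ_l.induct) auto

lemma typ_l_Var: "\<lbrakk>(x, A) \<in> \<Gamma>; finite \<Gamma>\<rbrakk> \<Longrightarrow> \<Gamma> \<turnstile>\<^sub>l Var x : A"
  using typ_l.Ax[of \<Gamma> x A] by (simp add: insert_absorb)

text \<open>Contexts are sets, so the principal assumption may be present in the premises as well;
  contraction is thereby implicit.\<close>

lemma typ_l_LArr:
  "\<lbrakk>(x, A1 \<^bold>\<rightarrow> A2) \<in> \<Gamma>; \<Gamma> \<turnstile>\<^sub>l N : A1; insert (y, A2) \<Gamma> \<turnstile>\<^sub>l Var y \<degree>\<degree> Ns : B;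
    \<forall>P \<in> set Ns. y \<notin> FV P; y \<notin> vars \<Gamma>\<rbrakk> \<Longrightarrow> \<Gamma> \<turnstile>\<^sub>l Var x \<degree> N \<degree>\<degree> Ns : B"
  using typ_l.LArr[of \<Gamma> N A1 y A2 Ns B x] by (simp add: insert_absorb)

lemma typ_l_LInt:
  "\<lbrakk>(x, A1 \<^bold>\<inter> A2) \<in> \<Gamma>; insert (x, A1) (insert (x, A2) \<Gamma>) \<turnstile>\<^sub>l Var x \<degree>\<degree> Ns : B\<rbrakk>
    \<Longrightarrow> \<Gamma> \<turnstile>\<^sub>l Var x \<degree>\<degree> Ns : B"
  using typ_l.LInt[of x A1 A2 \<Gamma> Ns B] by (simp add: insert_absorb)

section \<open>Renaming and weakening\<close>

text \<open>The accessibility relation of the Kripke model. Finiteness of the target is included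
  because the leaf rules require it.\<close>

definition renames :: "(nat \<Rightarrow> nat) \<Rightarrow> 'a ctx \<Rightarrow> 'a ctx \<Rightarrow> bool" where
  "renames r \<Gamma> \<Gamma>' \<longleftrightarrow> finite \<Gamma>' \<and> (\<forall>x A. (x, A) \<in> \<Gamma> \<longrightarrow> (r x, A) \<in> \<Gamma>')"

lemma renames_bind: "renames r \<Gamma> \<Gamma>' \<Longrightarrow> renames (up_ren r) (bind A \<Gamma>) (bind A \<Gamma>')"
  unfolding renames_def
proof (intro conjI allI impI)
  fix x B
  assume "finite \<Gamma>' \<and> (\<forall>x A. (x, A) \<in> \<Gamma> \<longrightarrow> (r x, A) \<in> \<Gamma>')" "(x, B) \<in> bind A \<Gamma>"
  then show "(up_ren r x, B) \<in> bind A \<Gamma>'" by (cases x) auto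
qed auto

lemma renames_fresh:
  "\<lbrakk>renames r \<Gamma> \<Gamma>'; y \<notin> vars \<Gamma>\<rbrakk>
    \<Longrightarrow> renames (r(y := y')) (insert (y, A) \<Gamma>) (insert (y', A) \<Gamma>')"
  by (force simp: renames_def)

lemma map_ren_fresh:
  assumes "\<forall>P \<in> set Ns. y \<notin> FV P"
  shows "map (ren (r(y := y'))) Ns = map (ren r) Ns"
  using assms by (auto intro!: ren_cong)

lemma ex_fresh:
  assumes "finite (\<Gamma> :: 'a ctx)"
  shows "\<exists>y. y \<notin> vars \<Gamma> \<and> (\<forall>P \<in> set Ns. y \<notin> FV P)"
proof -
  have "finite (vars \<Gamma> \<union> (\<Union>P \<in> set Ns. FV P))" using assms by simp
  from ex_new_if_finite[OF infinite_UNIV_nat this] show ?thesis by auto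
qed

lemma typ_l_ren:
  assumes "\<Gamma> \<turnstile>\<^sub>l M : A" "renames r \<Gamma> \<Gamma>'"
  shows "\<Gamma>' \<turnstile>\<^sub>l ren r M : A"
  using assms
proof (induction arbitrary: r \<Gamma>' rule: typ_l.induct)
  case (Ax \<Gamma> x A)
  then show ?case by (auto simp: renames_def intro: typ_l_Var)
next
  case (Beta \<Gamma> M N Ns A)
  then have "\<Gamma>' \<turnstile>\<^sub>l (ren (up_ren r) M)[0 \<^bold>:= ren r N] \<degree>\<degree> map (ren r) Ns : A"
    by (simp add: ren_subst)
  from typ_l.Beta[OF this] show ?case by simp
next
  case (LArr \<Gamma> N A1 y A2 Ns B x)
  have r: "renames r \<Gamma> \<Gamma>'" "finite \<Gamma>'" "(r x, A1 \<^bold>\<rightarrow> A2) \<in> \<Gamma>'"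
    using LArr.prems by (auto simp: renames_def)
  \<comment> \<open>\<open>y\<close> may clash with \<open>\<Gamma>'\<close> or with the renamed
    arguments, so a new variable takes its place.\<close>
  obtain y' where y': "y' \<notin> vars \<Gamma>'" "\<forall>P \<in> set (map (ren r) Ns). y' \<notin> FV P"
    using ex_fresh[OF r(2)] by blast
  have "insert (y', A2) \<Gamma>' \<turnstile>\<^sub>l ren (r(y := y')) (Var y \<degree>\<degree> Ns) : B"
    using LArr.IH(2) renames_fresh r LArr.hyps by blast
  then have "insert (y', A2) \<Gamma>' \<turnstile>\<^sub>l Var y' \<degree>\<degree> map (ren r) Ns : B"
    using LArr.hyps by (simp add: map_ren_fresh)
  then show ?case using typ_l_LArr[OF r(3) LArr.IH(1)[OF r(1)]] y' by simp
next
  case (RArr A \<Gamma> M B)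
  then show ?case by (auto intro: typ_l.RArr renames_bind)
next
  case (LInt x A1 A2 \<Gamma> Ns B)
  have "renames r (insert (x, A1) (insert (x, A2) \<Gamma>))
      (insert (r x, A1) (insert (r x, A2) \<Gamma>'))"
    using LInt.prems by (auto simp: renames_def)
  from LInt.IH[OF this] show ?case
    using LInt.prems typ_l_LInt[of "r x" A1 A2 \<Gamma>'] by (auto simp: renames_def)
next
  case (RInt \<Gamma> M A B)
  then show ?case by (simp add: typ_l.RInt)
next
  case (Om \<Gamma> M)
  then show ?case by (simp add: renames_def typ_l.Om)
qed

lemma typ_l_weaken: "\<lbrakk>\<Gamma> \<turnstile>\<^sub>l M : A; \<Gamma> \<subseteq> \<Gamma>'; finite \<Gamma>'\<rbrakk> \<Longrightarrow> \<Gamma>' \<turnstile>\<^sub>l M : A"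
  using typ_l_ren[of \<Gamma> M A "\<lambda>i. i" \<Gamma>'] by (auto simp: renames_def)

section \<open>Terms with a variable at the head\<close>

text \<open>No derivation for such a term ends with \<open>Beta\<close> or
  \<open>RArr\<close>.\<close>

primrec neutral :: "tm \<Rightarrow> bool" where
  "neutral (Var i) = True"
| "neutral (M \<degree> N) = neutral M"
| "neutral (Lam M) = False"

lemma neutral_apps [simp]: "neutral (M \<degree>\<degree> Ns) = neutral M"
  by (induction Ns arbitrary: M) auto

lemma neutral_ren [simp]: "neutral (ren r M) = neutral M"
  by (induction M) auto

text \<open>
  The renaming is part of the statement because the variable \<open>y\<close> of the rule LArr may have to be
  chosen afresh for \<open>N\<close>.
\<close>

lemma typ_l_neutral_App_ren:
  assumes "\<Gamma> \<turnstile>\<^sub>l M : A \<^bold>\<rightarrow> B" "neutral M" "renames r \<Gamma> \<Gamma>'" "\<Gamma>' \<turnstile>\<^sub>l N : A"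
  shows "\<Gamma>' \<turnstile>\<^sub>l ren r M \<degree> N : B"
  using assms
proof (induction \<Gamma> M "A \<^bold>\<rightarrow> B" arbitrary: r \<Gamma>' rule: typ_l.induct)
  case (Ax \<Gamma> x)
  have fin: "finite \<Gamma>'" using Ax by (simp add: renames_def)
  obtain y where y: "y \<notin> vars \<Gamma>'" using ex_fresh[OF fin, of "[]"] by blast
  \<comment> \<open>An axiom for a fresh \<open>y\<close> is the second premise of
    \<open>LArr\<close> with empty spine.\<close>
  have "insert (y, B) \<Gamma>' \<turnstile>\<^sub>l Var y \<degree>\<degree> [] : B" using fin by (auto intro: typ_l_Var)
  with Ax typ_l_LArr[of "r x" A B \<Gamma>' N y "[]" B] y show ?case
    by (auto simp: renames_def)
next
  case (LArr \<Gamma> N0 A1 y A2 Ns x)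
  have r: "renames r \<Gamma> \<Gamma>'" "finite \<Gamma>'" "(r x, A1 \<^bold>\<rightarrow> A2) \<in> \<Gamma>'"
    using LArr.prems by (auto simp: renames_def)
  \<comment> \<open>\<open>N\<close> joins the spine, so \<open>y'\<close> has to avoid it
    too.\<close>
  obtain y' where y': "y' \<notin> vars \<Gamma>'" "\<forall>P \<in> set (map (ren r) Ns @ [N]). y' \<notin> FV P"
    using ex_fresh[OF r(2)] by blast
  have r': "renames (r(y := y')) (insert (y, A2) \<Gamma>) (insert (y', A2) \<Gamma>')"
    using r(1) \<open>y \<notin> vars \<Gamma>\<close> by (rule renames_fresh)
  have "insert (y', A2) \<Gamma>' \<turnstile>\<^sub>l N : A"
    using LArr.prems(3) r(2) by (auto intro: typ_l_weaken)
  then have "insert (y', A2) \<Gamma>' \<turnstile>\<^sub>l ren (r(y := y')) (Var y \<degree>\<degree> Ns) \<degree> N : B"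
    using LArr.hyps(4)[OF _ r'] by simp
  then have "insert (y', A2) \<Gamma>' \<turnstile>\<^sub>l Var y' \<degree>\<degree> (map (ren r) Ns @ [N]) : B"
    using LArr.hyps by (simp add: map_ren_fresh)
  moreover have "\<Gamma>' \<turnstile>\<^sub>l ren r N0 : A1" using LArr.hyps(1) r(1) by (rule typ_l_ren)
  ultimately show ?case using typ_l_LArr[OF r(3)] y' by fastforce
next
  case (LInt x A1 A2 \<Gamma> Ns)
  let ?\<Gamma>' = "insert (r x, A1) (insert (r x, A2) \<Gamma>')"
  have r: "finite \<Gamma>'" "(r x, A1 \<^bold>\<inter> A2) \<in> \<Gamma>'" using LInt.prems by (auto simp: renames_def)
  have "renames r (insert (x, A1) (insert (x, A2) \<Gamma>)) ?\<Gamma>'"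
    using LInt.prems by (auto simp: renames_def)
  moreover have "?\<Gamma>' \<turnstile>\<^sub>l N : A"
    using r LInt.prems by (auto intro: typ_l_weaken)
  ultimately have "?\<Gamma>' \<turnstile>\<^sub>l Var (r x) \<degree>\<degree> (map (ren r) Ns @ [N]) : B"
    using LInt.hyps(2) by simp
  from typ_l_LInt[OF r(2) this] show ?case by simp
qed auto

text \<open>\<open>Beta\<close> and the left rules keep the type on the right and can be reapplied
  for each component; an axiom becomes \<open>LInt\<close> above an axiom for the component.\<close>

lemma typ_l_Inter_inv:
  assumes "\<Gamma> \<turnstile>\<^sub>l M : A \<^bold>\<inter> B"
  shows "\<Gamma> \<turnstile>\<^sub>l M : A \<and> \<Gamma> \<turnstile>\<^sub>l M : B"
  using assms
proof (induction \<Gamma> M "A \<^bold>\<inter> B" rule: typ_l.induct)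
  case (Ax \<Gamma> x)
  have "insert (x, A) (insert (x, B) \<Gamma>) \<turnstile>\<^sub>l Var x \<degree>\<degree> [] : C" if "C \<in> {A, B}" for C
    using that Ax by (auto intro!: typ_l_Var)
  from typ_l.LInt[OF this] show ?case by simp
next
  case (Beta \<Gamma> M N Ns)
  then show ?case using typ_l.Beta by blast
next
  case (LArr \<Gamma> N A1 y A2 Ns x)
  then show ?case using typ_l.LArr by blast
next
  case (LInt x A1 A2 \<Gamma> Ns)
  then show ?case using typ_l.LInt by blast
qed auto

section \<open>Cut elimination\<close>

text \<open>Derivability is a conjunct of the arrow clause, so that extracting it takes no eta-like
  argument; in the other clauses it follows from the rules.\<close>

primrec sem :: "'a ty \<Rightarrow> 'a ctx \<Rightarrow> tm \<Rightarrow> bool" where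
  "sem (Atom a) \<Gamma> M \<longleftrightarrow> \<Gamma> \<turnstile>\<^sub>l M : Atom a"
| "sem Omega \<Gamma> M \<longleftrightarrow> finite \<Gamma>"
| "sem (A \<^bold>\<rightarrow> B) \<Gamma> M \<longleftrightarrow> \<Gamma> \<turnstile>\<^sub>l M : A \<^bold>\<rightarrow> B \<and>
    (\<forall>r \<Gamma>' N. renames r \<Gamma> \<Gamma>' \<longrightarrow> sem A \<Gamma>' N \<longrightarrow> sem B \<Gamma>' (ren r M \<degree> N))"
| "sem (A \<^bold>\<inter> B) \<Gamma> M \<longleftrightarrow> sem A \<Gamma> M \<and> sem B \<Gamma> M"

lemma sem_imp_typ_l: "sem A \<Gamma> M \<Longrightarrow> \<Gamma> \<turnstile>\<^sub>l M : A"
  by (induction A) (simp_all add: typ_l.Om typ_l.RInt)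

text \<open>At an arrow, the argument is derivable by \<open>sem_imp_typ_l\<close>, so the
  application is derivable and again neutral, and the induction hypothesis for \<open>B\<close>
  applies.\<close>

lemma neutral_imp_sem: "\<lbrakk>\<Gamma> \<turnstile>\<^sub>l M : A; neutral M\<rbrakk> \<Longrightarrow> sem A \<Gamma> M"
proof (induction A arbitrary: \<Gamma> M)
  case Omega
  then show ?case by (auto dest: typ_l_finite)
next
  case (Arrow A B)
  have "sem B \<Gamma>' (ren r M \<degree> N)" if "renames r \<Gamma> \<Gamma>'" "sem A \<Gamma>' N" for r \<Gamma>' N
    using that Arrow.prems
    by (intro Arrow.IH) (auto intro: typ_l_neutral_App_ren sem_imp_typ_l)
  with Arrow.prems show ?case by simp
next
  case (Inter A B)
  then show ?case using typ_l_Inter_inv[OF Inter.prems(1)] by simp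
qed auto

lemma sem_ren: "\<lbrakk>sem A \<Gamma> M; renames r \<Gamma> \<Gamma>'\<rbrakk> \<Longrightarrow> sem A \<Gamma>' (ren r M)"
proof (induction A)
  case (Atom a)
  then show ?case by (auto intro: typ_l_ren)
next
  case Omega
  then show ?case by (simp add: renames_def)
next
  case (Arrow A B)
  have "sem B \<Gamma>'' (ren r' (ren r M) \<degree> N)" if "renames r' \<Gamma>' \<Gamma>''" "sem A \<Gamma>'' N" for r' \<Gamma>'' N
  proof -
    have "renames (\<lambda>i. r' (r i)) \<Gamma> \<Gamma>''"
      using that(1) Arrow.prems(2) by (simp add: renames_def)
    then show ?thesis using that(2) Arrow.prems(1) by (simp add: ren_ren)
  qed
  moreover have "\<Gamma>' \<turnstile>\<^sub>l ren r M : A \<^bold>\<rightarrow> B"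
    using sem_imp_typ_l[OF Arrow.prems(1)] Arrow.prems(2) by (rule typ_l_ren)
  ultimately show ?case by simp
next
  case (Inter A B)
  then show ?case by simp
qed

text \<open>The spine \<open>Ns\<close> is arbitrary because each arrow appends one more argument to
  it.\<close>

lemma sem_beta_expand: "sem A \<Gamma> (M[0 \<^bold>:= N] \<degree>\<degree> Ns) \<Longrightarrow> sem A \<Gamma> (Lam M \<degree> N \<degree>\<degree> Ns)"
proof (induction A arbitrary: \<Gamma> M N Ns)
  case (Arrow A B)
  have "sem B \<Gamma>' (ren r (Lam M \<degree> N \<degree>\<degree> Ns) \<degree> P)" if "renames r \<Gamma> \<Gamma>'" "sem A \<Gamma>' P" for r \<Gamma>' P
  proof -
    have "sem B \<Gamma>' (ren r (M[0 \<^bold>:= N] \<degree>\<degree> Ns) \<degree> P)" using Arrow.prems that by auto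
    then have "sem B \<Gamma>' ((ren (up_ren r) M)[0 \<^bold>:= ren r N] \<degree>\<degree> (map (ren r) Ns @ [P]))"
      by (simp add: ren_subst)
    from Arrow.IH(2)[OF this] show ?thesis by simp
  qed
  moreover have "\<Gamma> \<turnstile>\<^sub>l Lam M \<degree> N \<degree>\<degree> Ns : A \<^bold>\<rightarrow> B"
    using sem_imp_typ_l[OF Arrow.prems] by (rule typ_l.Beta)
  ultimately show ?case by simp
qed (auto intro: typ_l.Beta)

text \<open>The fundamental lemma. For an abstraction, the realizer supplied as argument extends the
  renamed substitution, and head expansion restores the redex.\<close>

lemma typ_omega_imp_sem:
  assumes "\<Delta> \<turnstile>\<^sub>\<omega> M : A" "finite \<Gamma>" "\<And>x B. (x, B) \<in> \<Delta> \<Longrightarrow> sem B \<Gamma> (\<sigma> x)"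
  shows "sem A \<Gamma> (psub \<sigma> M)"
  using assms
proof (induction arbitrary: \<Gamma> \<sigma> rule: typ_omega.induct)
  case (ArrI A \<Delta> M B)
  \<comment> \<open>Used twice: for any \<open>N\<close> in the functional part, and for the bound
    variable in the derivability part.\<close>
  have *: "sem B \<Gamma>' (psub (case_nat N (\<lambda>i. ren r (\<sigma> i))) M)"
    if "renames r \<Gamma> \<Gamma>'" "sem A \<Gamma>' N" for r \<Gamma>' N
  proof (rule ArrI.IH)
    show "finite \<Gamma>'" using that by (simp add: renames_def)
    show "sem C \<Gamma>' (case_nat N (\<lambda>i. ren r (\<sigma> i)) x)" if "(x, C) \<in> bind A \<Delta>" for x C
      using that ArrI.prems \<open>renames r \<Gamma> \<Gamma>'\<close> \<open>sem A \<Gamma>' N\<close> by (cases x) (auto intro: sem_ren)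
  qed
  have "sem B \<Gamma>' (ren r (psub \<sigma> (Lam M)) \<degree> N)" if "renames r \<Gamma> \<Gamma>'" "sem A \<Gamma>' N" for r \<Gamma>' N
  proof -
    have "sem B \<Gamma>' ((psub (up (\<lambda>i. ren r (\<sigma> i))) M)[0 \<^bold>:= N] \<degree>\<degree> [])"
      using *[OF that] by (simp add: psub_up_subst)
    from sem_beta_expand[OF this] show ?thesis
      unfolding ren_psub by simp
  qed
  moreover have "\<Gamma> \<turnstile>\<^sub>l psub \<sigma> (Lam M) : A \<^bold>\<rightarrow> B"
  proof -
    \<comment> \<open>With renaming \<open>Suc\<close> and argument \<open>Var 0\<close>, the
      extended substitution is \<open>up \<sigma>\<close>.\<close>
    have "renames Suc \<Gamma> (bind A \<Gamma>)" using ArrI.prems by (simp add: renames_def)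
    moreover have "sem A (bind A \<Gamma>) (Var 0)"
      using ArrI.prems(1) by (intro neutral_imp_sem typ_l_Var) auto
    ultimately have "sem B (bind A \<Gamma>) (psub (up \<sigma>) M)"
      using * by (simp add: up_def lift_0)
    then show ?thesis by (auto intro: typ_l.RArr sem_imp_typ_l)
  qed
  ultimately show ?case by simp
next
  case (ArrE \<Delta> M A B N)
  have "sem (A \<^bold>\<rightarrow> B) \<Gamma> (psub \<sigma> M)" "sem A \<Gamma> (psub \<sigma> N)"
    using ArrE by blast+
  moreover have "renames (\<lambda>i. i) \<Gamma> \<Gamma>" using ArrE.prems by (simp add: renames_def)
  ultimately have "sem B \<Gamma> (ren (\<lambda>i. i) (psub \<sigma> M) \<degree> psub \<sigma> N)" unfolding sem.simps by blast
  then show ?case by simp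
next
  case (IntE1 \<Delta> M A B)
  then have "sem (A \<^bold>\<inter> B) \<Gamma> (psub \<sigma> M)" by blast
  then show ?case by simp
next
  case (IntE2 \<Delta> M A B)
  then have "sem (A \<^bold>\<inter> B) \<Gamma> (psub \<sigma> M)" by blast
  then show ?case by simp
qed auto

text \<open>The identity substitution is admissible in the fundamental lemma because variables are
  neutral.\<close>

lemma typ_omega_imp_typ_l:
  assumes "\<Delta> \<turnstile>\<^sub>\<omega> M : A" "finite \<Gamma>" "\<And>x B. (x, B) \<in> \<Delta> \<Longrightarrow> \<Gamma> \<turnstile>\<^sub>l Var x : B"
  shows "\<Gamma> \<turnstile>\<^sub>l M : A"
proof -
  have "sem A \<Gamma> (psub Var M)"
    using assms by (intro typ_omega_imp_sem) (auto intro: neutral_imp_sem)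
  then show ?thesis by (simp add: sem_imp_typ_l)
qed

section \<open>Equivalence of the systems\<close>

lemma typ_s_iff_typ_l: "\<Gamma> \<turnstile>\<^sub>s M : A \<longleftrightarrow> \<Gamma> \<turnstile>\<^sub>l M : A"
proof
  show "\<Gamma> \<turnstile>\<^sub>l M : A" if "\<Gamma> \<turnstile>\<^sub>s M : A"
    using that by (induction rule: typ_s.induct) (auto intro: typ_l.intros)
  show "\<Gamma> \<turnstile>\<^sub>s M : A" if "\<Gamma> \<turnstile>\<^sub>l M : A"
    using that
  proof (induction rule: typ_l.induct)
    case (Beta \<Gamma> M N Ns A)
    \<comment> \<open>The premise for \<open>N\<close> is supplied at the type
      \<open>Omega\<close>.\<close>
    then show ?case using typ_l_finite by (blast intro: typ_s.Beta typ_s.Om)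
  qed (auto intro: typ_s.intros)
qed

text \<open>Repeated elimination reaches every member, whatever order and bracketing was
  chosen.\<close>

lemma inter_of_typ_omega:
  "\<lbrakk>inter_of S A; \<Delta> \<turnstile>\<^sub>\<omega> M : A; B \<in> S\<rbrakk> \<Longrightarrow> \<Delta> \<turnstile>\<^sub>\<omega> M : B"
  by (induction rule: inter_of.induct) (auto dest: typ_omega.IntE1 typ_omega.IntE2)

lemma inter_of_typ_l:
  "\<lbrakk>inter_of S A; \<And>B. B \<in> S \<Longrightarrow> \<Gamma> \<turnstile>\<^sub>l M : B\<rbrakk> \<Longrightarrow> \<Gamma> \<turnstile>\<^sub>l M : A"
  by (induction rule: inter_of.induct) (auto intro: typ_l.RInt)

lemma inter_ctx_finite:
  assumes "finite \<Gamma>" "inter_ctx \<Gamma> \<Delta>"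
  shows "finite \<Delta>"
proof -
  have "inj_on fst \<Delta>" "finite (fst ` \<Delta>)"
    using assms by (auto simp: inter_ctx_def inj_on_def single_valued_def)
  then show ?thesis by (blast intro: finite_imageD)
qed

theorem theorem8:
  fixes \<Gamma> \<Delta> :: "'a ctx" and M :: tm and A :: "'a ty"
  assumes "finite \<Gamma>" and "inter_ctx \<Gamma> \<Delta>"
  shows "(\<Delta> \<turnstile>\<^sub>\<omega> M : A \<longleftrightarrow> \<Gamma> \<turnstile>\<^sub>s M : A) \<and> (\<Gamma> \<turnstile>\<^sub>s M : A \<longleftrightarrow> \<Gamma> \<turnstile>\<^sub>l M : A)"
proof -
  have fin: "finite \<Delta>" using assms by (rule inter_ctx_finite)
  have sv: "single_valued \<Delta>" and vars: "vars \<Delta> = vars \<Gamma>"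
    and inter: "\<And>x B. (x, B) \<in> \<Delta> \<Longrightarrow> inter_of {C. (x, C) \<in> \<Gamma>} B"
    using assms(2) by (auto simp: inter_ctx_def)
  have "\<Delta> \<turnstile>\<^sub>\<omega> M : A \<longleftrightarrow> \<Gamma> \<turnstile>\<^sub>l M : A"
  proof
    assume "\<Delta> \<turnstile>\<^sub>\<omega> M : A"
    then show "\<Gamma> \<turnstile>\<^sub>l M : A"
      using assms(1)
    proof (rule typ_omega_imp_typ_l)
      show "\<Gamma> \<turnstile>\<^sub>l Var x : B" if "(x, B) \<in> \<Delta>" for x B
        using inter[OF that] assms(1) by (auto intro: inter_of_typ_l typ_l_Var)
    qed
  next
    assume "\<Gamma> \<turnstile>\<^sub>l M : A"
    then show "\<Delta> \<turnstile>\<^sub>\<omega> M : A"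
      using fin sv
    proof (rule typ_l_imp_typ_omega)
      fix x B
      assume xB: "(x, B) \<in> \<Gamma>"
      \<comment> \<open>The type of \<open>x\<close> in \<open>\<Delta>\<close> is an intersection
        having \<open>B\<close> among its members.\<close>
      then have "x \<in> vars \<Delta>" unfolding vars by force
      then obtain C where "(x, C) \<in> \<Delta>" by auto
      then show "\<Delta> \<turnstile>\<^sub>\<omega> Var x : B"
        using inter_of_typ_omega[OF inter typ_omega_Var] fin sv xB by blast
    qed
  qed
  then show ?thesis by (simp add: typ_s_iff_typ_l)
qed

end
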